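(* Let $B=\{b_k(x)\}_{k=0}^\infty$ be a simple set of polynomials. If every classical multiplier sequence is a $B$-multiplier sequence, then there exists a real number $\alpha>1$ such that $\{\alpha^k\}_{k=0}^\infty$ and $\{(1/\alpha)^k\}_{k=0}^\infty$ are both $B$-multiplier sequences.
   Context: All polynomials have real coefficients. A simple set of polynomials is a sequence $Q=\{q_k(x)\}_{k=0}^\infty$ of real polynomials with $\deg q_k=k$ for $k=0,1,2,\ldots$ (so $q_0$ is a nonzero constant, and $Q$ is a basis of $\mathbb{R}[x]$). A polynomial "has only real zeros" if it has no non-real complex zeros or is identically zero (nonzero constants also qualify). A sequence of real numbers $\{\gamma_k\}_{k=0}^\infty$ is a $Q$-multiplier sequence if, for every $n$ and all real $a_0,\ldots,a_n$, the polynomial $\sum_{k=0}^n a_k\gamma_k q_k(x)$ has only real zeros whenever $\sum_{k=0}^n a_k q_k(x)$ has only real zeros. A classical multiplier sequence is a $Q$-multiplier sequence for the standard basis $Q=\{x^k\}_{k=0}^\infty$. *)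

theory Defs
  imports Complex_Main "HOL-Computational_Algebra.Polynomial"
begin

(* The condition q k \<noteq> 0 only matters for k = 0: the zero polynomial has degree 0 here. *)
definition simple_set :: "(nat \<Rightarrow> real poly) \<Rightarrow> bool" where
  "simple_set q \<longleftrightarrow> (\<forall>k. q k \<noteq> 0 \<and> degree (q k) = k)"

definition only_real_zeros :: "real poly \<Rightarrow> bool" where
  "only_real_zeros p \<longleftrightarrow>
     p = 0 \<or> (\<forall>z::complex. poly (map_poly complex_of_real p) z = 0 \<longrightarrow> z \<in> \<real>)"

definition multiplier_sequence :: "(nat \<Rightarrow> real poly) \<Rightarrow> (nat \<Rightarrow> real) \<Rightarrow> bool" where
  "multiplier_sequence q \<gamma> \<longleftrightarrow>
     (\<forall>(n::nat) (a::nat \<Rightarrow> real).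
        only_real_zeros (\<Sum>k\<le>n. smult (a k) (q k)) \<longrightarrow>
        only_real_zeros (\<Sum>k\<le>n. smult (a k * \<gamma> k) (q k)))"

definition classical_multiplier_sequence :: "(nat \<Rightarrow> real) \<Rightarrow> bool" where
  "classical_multiplier_sequence \<gamma> \<longleftrightarrow> multiplier_sequence (\<lambda>k. monom 1 k) \<gamma>"

end

theory Submission
  imports Defs
begin

text \<open>
  A geometric sequence with nonzero real ratio \<open>c\<close> acts on the standard basis as the dilation
  \<open>p(x) \<mapsto> p(c x)\<close>. A dilation merely divides every complex zero by the real number \<open>c\<close>, so it
  preserves reality of zeros: geometric sequences are classical multiplier sequences. The
  hypothesis on \<open>b\<close> transfers this to \<open>b\<close> for every ratio at once, so any \<open>\<alpha> > 1\<close>, together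
  with its reciprocal, is a witness.
\<close>

lemma sum_monom_geometric_eq_pcompose:
  fixes a :: "nat \<Rightarrow> real"
  shows "(\<Sum>k\<le>n. smult (a k * c ^ k) (monom 1 k)) =
         (\<Sum>k\<le>n. smult (a k) (monom 1 k)) \<circ>\<^sub>p [:0, c:]"
  by (simp add: poly_eq_poly_eq_iff [symmetric] fun_eq_iff poly_pcompose poly_sum poly_monom
      power_mult_distrib mult_ac)

lemma poly_map_complex_of_real_dilation:
  "poly (map_poly complex_of_real (p \<circ>\<^sub>p [:0, c:])) z =
   poly (map_poly complex_of_real p) (complex_of_real c * z)"
proof (induction p)
  case (pCons a p)
  have "pCons a p \<circ>\<^sub>p [:0, c:] = pCons a (smult c (p \<circ>\<^sub>p [:0, c:]))"
    by (simp add: pcompose_pCons)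
  with pCons show ?case
    by (simp add: map_poly_pCons map_poly_smult mult_ac)
qed simp

lemma only_real_zeros_dilation:
  assumes "only_real_zeros p" and "c \<noteq> 0"
  shows "only_real_zeros (p \<circ>\<^sub>p [:0, c:])"
proof (cases "p = 0")
  case False
  have "z \<in> \<real>" if "poly (map_poly complex_of_real (p \<circ>\<^sub>p [:0, c:])) z = 0" for z
  proof -
    have "complex_of_real c * z \<in> \<real>"
      using that assms(1) False
      by (auto simp: only_real_zeros_def poly_map_complex_of_real_dilation)
    then have "complex_of_real c * z / complex_of_real c \<in> \<real>"
      by (intro Reals_divide) auto
    with assms(2) show ?thesis by simp
  qed
  then show ?thesis by (simp add: only_real_zeros_def)
qed (simp add: only_real_zeros_def)

lemma classical_multiplier_sequence_geometric:
  assumes "c \<noteq> 0"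
  shows "classical_multiplier_sequence (\<lambda>k. c ^ k)"
  using only_real_zeros_dilation[OF _ assms]
  by (simp add: classical_multiplier_sequence_def multiplier_sequence_def
      sum_monom_geometric_eq_pcompose)

theorem theorem3:
  fixes b :: "nat \<Rightarrow> real poly"
  assumes "simple_set b"
    and "\<And>\<gamma>. classical_multiplier_sequence \<gamma> \<Longrightarrow> multiplier_sequence b \<gamma>"
  shows "\<exists>\<alpha>::real. \<alpha> > 1 \<and> multiplier_sequence b (\<lambda>k. \<alpha> ^ k)
           \<and> multiplier_sequence b (\<lambda>k. (1 / \<alpha>) ^ k)"
proof (intro exI conjI)
  show "(2::real) > 1" by simp
  show "multiplier_sequence b (\<lambda>k. 2 ^ k)"
    by (intro assms(2) classical_multiplier_sequence_geometric) simp
  show "multiplier_sequence b (\<lambda>k. (1 / 2) ^ k)"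
    by (intro assms(2) classical_multiplier_sequence_geometric) simp
qed

end
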